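(* Let $\mathbb{C}$ be a unital moment category. Pushforward along any morphism $f:A\to B$ takes disjoint moments of $A$ to disjoint moments of $B$. If $f$ is active, then $f_*$ induces a partition of the set of elementary moments of $B$, indexed by the elementary moments of $A$: the part indexed by an elementary moment $\alpha$ of $A$ is the set of elementary moments $\beta$ of $B$ with $\beta\le f_*(\alpha)$ (parts may be empty).
   Context: A class of morphisms is closed if it is closed under composition and contains all isomorphisms. An active/inert factorisation system on a category consists of two closed classes, of active and of inert morphisms, such that every morphism factors as $f=f_{in}f_{act}$ ($f_{act}$ active, $f_{in}$ inert), and for two such factorisations $f_{in}f_{act}=f'_{in}f'_{act}$ there is a unique isomorphism $h$ with $f_{in}=f'_{in}h$, $hf_{act}=f'_{act}$. A moment category is a category with an active/inert factorisation system such that (M1) every inert morphism has a unique active retraction; (M2) if $fi=g$ with $i$ inert and $f,g$ active, then $f=gr$ where $r$ is the unique active retraction of $i$. A moment of $A$ is an endomorphism $\phi=\phi_{in}\phi_{act}$ of $A$ ($\phi_{act}:A\to B$, $\phi_{in}:B\to A$) with $\phi_{act}\phi_{in}=1_B$; it splits over $B$. The pushforward of a moment $\phi=\phi_{in}\phi_{act}$ of $A$ along $f:A\to B$ is the moment $f_*(\phi)=\psi_{in}\psi_{act}$ of $B$, where $\psi_{in}$ is the inert part of $f\phi_{in}$ and $\psi_{act}$ its unique active retraction. For moments $\phi,\psi$ of the same object: $\phi\le\psi$ ($\phi$ is a submoment of $\psi$) if $\psi\phi=\phi$; $\phi$ and $\psi$ are congruent if $\phi=\phi\psi\phi$ and $\psi=\psi\phi\psi$.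 A unit is an object $U$ such that (U1) $U$ is primitive, i.e. $U$ has non-identity moments and all of them are congruent; (U2) each active morphism with target $U$ has exactly one inert section. A moment category is unital if for each object $A$ there is an essentially unique pair $(U,\phi)$ of a unit $U$ and an active morphism $\phi:U\to A$. A moment is elementary if it splits over a unit. Two moments of the same object are disjoint if they share no common elementary submoment. *)

theory Defs
  imports Main "HOL-Library.Disjoint_Sets"
begin

text \<open>
  Categories are presented by a set of objects and a set of arrows inside two types.
  Composition is written in the usual order and is meaningful only for composable arrows.
\<close>

record ('o, 'm) cat =
  Obj :: "'o set"
  Arr :: "'m set"
  Dom :: "'m \<Rightarrow> 'o"
  Cod :: "'m \<Rightarrow> 'o"
  Id  :: "'o \<Rightarrow> 'm"
  Comp :: "'m \<Rightarrow> 'm \<Rightarrow> 'm"  (infixr "\<cdot>\<index>" 70)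

definition hom :: "('o, 'm, 'x) cat_scheme \<Rightarrow> 'o \<Rightarrow> 'o \<Rightarrow> 'm set" where
  "hom C A B = {f \<in> Arr C. Dom C f = A \<and> Cod C f = B}"

locale category =
  fixes C :: "('o, 'm, 'x) cat_scheme" (structure)
  assumes Dom_Obj: "f \<in> Arr C \<Longrightarrow> Dom C f \<in> Obj C"
    and Cod_Obj: "f \<in> Arr C \<Longrightarrow> Cod C f \<in> Obj C"
    and Id_hom: "A \<in> Obj C \<Longrightarrow> Id C A \<in> hom C A A"
    and Comp_hom: "\<lbrakk>f \<in> hom C A B; g \<in> hom C B D\<rbrakk> \<Longrightarrow> g \<cdot> f \<in> hom C A D"
    and Comp_Id_right: "f \<in> hom C A B \<Longrightarrow> f \<cdot> Id C A = f"
    and Comp_Id_left: "f \<in> hom C A B \<Longrightarrow> Id C B \<cdot> f = f"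
    and Comp_assoc: "\<lbrakk>f \<in> hom C A B; g \<in> hom C B D; h \<in> hom C D E\<rbrakk>
                       \<Longrightarrow> (h \<cdot> g) \<cdot> f = h \<cdot> (g \<cdot> f)"

definition isos :: "('o, 'm, 'x) cat_scheme \<Rightarrow> 'o \<Rightarrow> 'o \<Rightarrow> 'm set" where
  "isos C A B = {f \<in> hom C A B. \<exists>g \<in> hom C B A.
                   Comp C g f = Id C A \<and> Comp C f g = Id C B}"

definition closed_class :: "('o, 'm, 'x) cat_scheme \<Rightarrow> 'm set \<Rightarrow> bool" where
  "closed_class C K \<longleftrightarrow>
     K \<subseteq> Arr C \<and>
     (\<forall>A B D. \<forall>f \<in> K \<inter> hom C A B. \<forall>g \<in> K \<inter> hom C B D. Comp C g f \<in> K) \<and>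
     (\<forall>A B. isos C A B \<subseteq> K)"

record ('o, 'm) ai_cat = "('o, 'm) cat" +
  Act :: "'m set"
  Inert :: "'m set"

definition act :: "('o, 'm, 'x) ai_cat_scheme \<Rightarrow> 'o \<Rightarrow> 'o \<Rightarrow> 'm set" where
  "act C A B = Act C \<inter> hom C A B"

definition inert :: "('o, 'm, 'x) ai_cat_scheme \<Rightarrow> 'o \<Rightarrow> 'o \<Rightarrow> 'm set" where
  "inert C A B = Inert C \<inter> hom C A B"

locale active_inert_category = category C
  for C :: "('o, 'm, 'x) ai_cat_scheme" (structure) +
  assumes closed_Act: "closed_class C (Act C)"
    and closed_Inert: "closed_class C (Inert C)"
    and factorisation:
      "f \<in> hom C A B \<Longrightarrow> \<exists>X. \<exists>a \<in> act C A X. \<exists>i \<in> inert C X B. f = i \<cdot> a"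
    and factorisation_unique:
      "\<lbrakk>a \<in> act C A X; i \<in> inert C X B; a' \<in> act C A X'; i' \<in> inert C X' B; i \<cdot> a = i' \<cdot> a'\<rbrakk>
         \<Longrightarrow> \<exists>!h. h \<in> isos C X X' \<and> i = i' \<cdot> h \<and> h \<cdot> a = a'"

definition active_retraction :: "('o, 'm, 'x) ai_cat_scheme \<Rightarrow> 'm \<Rightarrow> 'm \<Rightarrow> bool" where
  "active_retraction C i r \<longleftrightarrow>
     r \<in> act C (Cod C i) (Dom C i) \<and> Comp C r i = Id C (Dom C i)"

locale moment_category = active_inert_category C
  for C :: "('o, 'm, 'x) ai_cat_scheme" (structure) +
  assumes M1: "i \<in> inert C A B \<Longrightarrow> \<exists>!r. active_retraction C i r"
    and M2: "\<lbrakk>i \<in> inert C A B; f \<in> act C B D; g \<in> act C A D; f \<cdot> i = g; active_retraction C i r\<rbrakk>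
               \<Longrightarrow> f = g \<cdot> r"

definition splitting ::
  "('o, 'm, 'x) ai_cat_scheme \<Rightarrow> 'o \<Rightarrow> 'm \<Rightarrow> 'o \<Rightarrow> 'm \<Rightarrow> 'm \<Rightarrow> bool" where
  "splitting C A \<phi> B i a \<longleftrightarrow>
     a \<in> act C A B \<and> i \<in> inert C B A \<and> \<phi> = Comp C i a \<and> Comp C a i = Id C B"

definition splits_over :: "('o, 'm, 'x) ai_cat_scheme \<Rightarrow> 'o \<Rightarrow> 'm \<Rightarrow> 'o \<Rightarrow> bool" where
  "splits_over C A \<phi> B \<longleftrightarrow> (\<exists>i a. splitting C A \<phi> B i a)"

definition moments :: "('o, 'm, 'x) ai_cat_scheme \<Rightarrow> 'o \<Rightarrow> 'm set" where
  "moments C A = {\<phi>. \<exists>B. splits_over C A \<phi> B}"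

text \<open>
  The factorisations of \<open>\<phi>\<close> and of \<open>f \<cdot> \<phi>\<^sub>i\<^sub>n\<close> are determined only up to unique isomorphism,
  but the resulting endomorphism does not depend on them
  (lemma \<open>pushforward_unique\<close> below), which justifies the definite description.
\<close>

definition is_pushforward :: "('o, 'm, 'x) ai_cat_scheme \<Rightarrow> 'm \<Rightarrow> 'm \<Rightarrow> 'm \<Rightarrow> bool" where
  "is_pushforward C f \<phi> \<psi> \<longleftrightarrow>
     (\<exists>X i a Y g j s.
        splitting C (Dom C f) \<phi> X i a \<and>
        g \<in> act C X Y \<and> j \<in> inert C Y (Cod C f) \<and> Comp C f i = Comp C j g \<and>
        active_retraction C j s \<and> \<psi> = Comp C j s)"

definition pushforward :: "('o, 'm, 'x) ai_cat_scheme \<Rightarrow> 'm \<Rightarrow> 'm \<Rightarrow> 'm" where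
  "pushforward C f \<phi> = (THE \<psi>. is_pushforward C f \<phi> \<psi>)"

definition submoment :: "('o, 'm, 'x) ai_cat_scheme \<Rightarrow> 'o \<Rightarrow> 'm \<Rightarrow> 'm \<Rightarrow> bool" where
  "submoment C A \<phi> \<psi> \<longleftrightarrow> \<phi> \<in> moments C A \<and> \<psi> \<in> moments C A \<and> Comp C \<psi> \<phi> = \<phi>"

definition congruent_moments :: "('o, 'm, 'x) ai_cat_scheme \<Rightarrow> 'o \<Rightarrow> 'm \<Rightarrow> 'm \<Rightarrow> bool" where
  "congruent_moments C A \<phi> \<psi> \<longleftrightarrow>
     \<phi> \<in> moments C A \<and> \<psi> \<in> moments C A \<and>
     \<phi> = Comp C \<phi> (Comp C \<psi> \<phi>) \<and> \<psi> = Comp C \<psi> (Comp C \<phi> \<psi>)"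

text \<open>
  The identity is congruent only to itself, so congruence is required of the
  non-identity moments of a primitive object.
\<close>

definition primitive :: "('o, 'm, 'x) ai_cat_scheme \<Rightarrow> 'o \<Rightarrow> bool" where
  "primitive C U \<longleftrightarrow>
     U \<in> Obj C \<and> moments C U - {Id C U} \<noteq> {} \<and>
     (\<forall>\<phi> \<in> moments C U - {Id C U}. \<forall>\<psi> \<in> moments C U - {Id C U}. congruent_moments C U \<phi> \<psi>)"

definition unit_object :: "('o, 'm, 'x) ai_cat_scheme \<Rightarrow> 'o \<Rightarrow> bool" where
  "unit_object C U \<longleftrightarrow>
     primitive C U \<and>
     (\<forall>A. \<forall>a \<in> act C A U. \<exists>!i. i \<in> inert C U A \<and> Comp C a i = Id C U)"

text \<open>
  ``Essentially unique'' is read as unique up to isomorphism of pairs. Uniqueness of that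
  isomorphism is not demanded, so this covers the reading ``up to unique isomorphism'' as well.
\<close>

locale unital_moment_category = moment_category C
  for C :: "('o, 'm, 'x) ai_cat_scheme" (structure) +
  assumes unital_ex: "A \<in> Obj C \<Longrightarrow> \<exists>U \<phi>. unit_object C U \<and> \<phi> \<in> act C U A"
    and unital_unique:
      "\<lbrakk>unit_object C U; \<phi> \<in> act C U A; unit_object C U'; \<phi>' \<in> act C U' A\<rbrakk>
         \<Longrightarrow> \<exists>h \<in> isos C U U'. \<phi>' \<cdot> h = \<phi>"

definition elementary_moments :: "('o, 'm, 'x) ai_cat_scheme \<Rightarrow> 'o \<Rightarrow> 'm set" where
  "elementary_moments C A = {\<phi> \<in> moments C A. \<exists>U. unit_object C U \<and> splits_over C A \<phi> U}"

definition disjoint_moments :: "('o, 'm, 'x) ai_cat_scheme \<Rightarrow> 'o \<Rightarrow> 'm \<Rightarrow> 'm \<Rightarrow> bool" where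
  "disjoint_moments C A \<phi> \<psi> \<longleftrightarrow>
     \<phi> \<in> moments C A \<and> \<psi> \<in> moments C A \<and>
     \<not> (\<exists>\<epsilon> \<in> elementary_moments C A. submoment C A \<epsilon> \<phi> \<and> submoment C A \<epsilon> \<psi>)"

context active_inert_category
begin

lemma iso_hom: "h \<in> isos C A B \<Longrightarrow> h \<in> hom C A B"
  by (simp add: isos_def)

lemma iso_act: "h \<in> isos C A B \<Longrightarrow> h \<in> act C A B"
  using closed_Act iso_hom unfolding act_def closed_class_def by blast

lemma act_hom: "a \<in> act C A B \<Longrightarrow> a \<in> hom C A B"
  by (simp add: act_def)

lemma inert_hom: "i \<in> inert C A B \<Longrightarrow> i \<in> hom C A B"
  by (simp add: inert_def)

lemma act_comp: "a \<in> act C A B \<Longrightarrow> b \<in> act C B D \<Longrightarrow> b \<cdot> a \<in> act C A D"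
  using closed_Act Comp_hom unfolding act_def closed_class_def by blast

end

context moment_category
begin

lemma active_retraction_iff:
  "i \<in> inert C A B \<Longrightarrow> active_retraction C i r \<longleftrightarrow> r \<in> act C B A \<and> r \<cdot> i = Id C A"
  by (simp add: active_retraction_def inert_def hom_def)

lemma pushforward_exists:
  assumes f: "f \<in> hom C A B" and \<phi>: "\<phi> \<in> moments C A"
  shows "\<exists>\<psi>. is_pushforward C f \<phi> \<psi>"
proof -
  obtain X i a where s: "splitting C A \<phi> X i a"
    using \<phi> by (auto simp: moments_def splits_over_def)
  then have i: "i \<in> hom C X A" by (simp add: splitting_def inert_def)
  obtain Y g j where "g \<in> act C X Y" "j \<in> inert C Y B" "f \<cdot> i = j \<cdot> g"
    using factorisation[OF Comp_hom[OF i f]] by blast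
  moreover obtain r where "active_retraction C j r"
    using M1[OF \<open>j \<in> inert C Y B\<close>] by blast
  moreover have "Dom C f = A" "Cod C f = B" using f by (auto simp: hom_def)
  ultimately show ?thesis
    using s unfolding is_pushforward_def by blast
qed

lemma pushforward_unique:
  assumes f: "f \<in> hom C A B"
    and \<psi>: "is_pushforward C f \<phi> \<psi>" and \<psi>': "is_pushforward C f \<phi> \<psi>'"
  shows "\<psi> = \<psi>'"
proof -
  have [simp]: "Dom C f = A" "Cod C f = B" using f by (auto simp: hom_def)
  obtain X i a Y g j s where
    1: "i \<in> inert C X A" "a \<in> act C A X" "\<phi> = i \<cdot> a" "g \<in> act C X Y" "j \<in> inert C Y B"
       "f \<cdot> i = j \<cdot> g" "active_retraction C j s" "\<psi> = j \<cdot> s"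
    using \<psi> by (auto simp: is_pushforward_def splitting_def)
  obtain X' i' a' Y' g' j' s' where
    2: "i' \<in> inert C X' A" "a' \<in> act C A X'" "\<phi> = i' \<cdot> a'" "g' \<in> act C X' Y'"
       "j' \<in> inert C Y' B" "f \<cdot> i' = j' \<cdot> g'" "active_retraction C j' s'" "\<psi>' = j' \<cdot> s'"
    using \<psi>' by (auto simp: is_pushforward_def splitting_def)
  obtain k where k: "k \<in> isos C X X'" "i = i' \<cdot> k"
    using factorisation_unique[OF 1(2,1) 2(2,1)] 1(3) 2(3) by auto
  have "j \<cdot> g = (f \<cdot> i') \<cdot> k"
    using Comp_assoc[OF iso_hom[OF k(1)] inert_hom[OF 2(1)] f] 1(6) k(2) by simp
  also have "\<dots> = j' \<cdot> (g' \<cdot> k)"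
    using Comp_assoc[OF iso_hom[OF k(1)] act_hom[OF 2(4)] inert_hom[OF 2(5)]] 2(6) by simp
  finally obtain h where h: "h \<in> isos C Y Y'" "j = j' \<cdot> h"
    using factorisation_unique[OF 1(4,5) act_comp[OF iso_act[OF k(1)] 2(4)] 2(5)] by auto
  obtain l where l: "l \<in> hom C Y' Y" "h \<cdot> l = Id C Y'"
    using h(1) by (auto simp: isos_def)
  have s: "s \<in> act C B Y" "s \<cdot> j = Id C Y"
    using 1(5,7) active_retraction_iff by auto
  note H = iso_hom[OF h(1)] and J' = inert_hom[OF 2(5)] and S = act_hom[OF s(1)]
  have "j' = j \<cdot> l"
    using Comp_assoc[OF l(1) H J'] l(2) h(2) Comp_Id_right[OF J'] by simp
  then have "s \<cdot> j' = l"
    using Comp_assoc[OF l(1) inert_hom[OF 1(5)] S] s(2) Comp_Id_left[OF l(1)] by simp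
  then have "(h \<cdot> s) \<cdot> j' = Id C Y'"
    using Comp_assoc[OF J' S H] l(2) by simp
  then have "active_retraction C j' (h \<cdot> s)"
    using active_retraction_iff[OF 2(5)] act_comp[OF s(1) iso_act[OF h(1)]] by simp
  then have "s' = h \<cdot> s"
    using M1[OF 2(5)] 2(7) by blast
  then show ?thesis
    using 1(8) 2(8) h(2) Comp_assoc[OF S H J'] by simp
qed

lemma is_pushforward_pushforward:
  assumes "f \<in> hom C A B" and "\<phi> \<in> moments C A"
  shows "is_pushforward C f \<phi> (pushforward C f \<phi>)"
  unfolding pushforward_def
  using theI'[of "is_pushforward C f \<phi>"] pushforward_exists[OF assms] pushforward_unique[OF assms(1)]
  by blast

lemma pushforward_moment:
  assumes "f \<in> hom C A B" and "\<phi> \<in> moments C A"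
  shows "pushforward C f \<phi> \<in> moments C B"
proof -
  have [simp]: "Dom C f = A" "Cod C f = B" using assms(1) by (auto simp: hom_def)
  show ?thesis
    using is_pushforward_pushforward[OF assms] active_retraction_iff
    unfolding is_pushforward_def moments_def splits_over_def splitting_def by fastforce
qed

end

end

(* Pull elementary moments back instead of pushing disjointness forward. If an elementary moment
   \<beta> = b \<cdot> p of B, with p : B -> V active and V a unit, lies below a pushforward along f : A -> B,
   then p \<cdot> f is active. By (U2) it has a unique inert section m : V -> A, and m \<cdot> (p \<cdot> f) is an
   elementary moment of A that depends only on \<beta> and f; it lies below every moment of A whose
   pushforward lies above \<beta>. Hence pushforward preserves disjointness. If f is active, then p \<cdot> f
   is always active and \<beta> lies below the pushforward of its pullback. Comparable elementary
   moments are equal because an active morphism between units is invertible, so distinct elementary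
   moments are disjoint and the pullback is the only index of \<beta>. *)

theory Submission
  imports Defs
begin

section \<open>Closure of the two classes and active cancellation\<close>

lemma (in active_inert_category) inert_comp:
  "i \<in> inert C A B \<Longrightarrow> j \<in> inert C B D \<Longrightarrow> j \<cdot> i \<in> inert C A D"
  using closed_Inert Comp_hom unfolding inert_def closed_class_def by blast

lemma (in active_inert_category) iso_inert: "h \<in> isos C A B \<Longrightarrow> h \<in> inert C A B"
  using closed_Inert iso_hom unfolding inert_def closed_class_def by blast

lemma (in active_inert_category) Id_iso: "A \<in> Obj C \<Longrightarrow> Id C A \<in> isos C A A"
  using Id_hom Comp_Id_left unfolding isos_def by blast

context moment_category
begin

text \<open>The inert part \<open>x\<close> of \<open>p\<close> has an active retraction, which
  makes \<open>y \<cdot> q\<close> active. Then \<open>x \<cdot> (y \<cdot> q)\<close> and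
  \<open>Id C D \<cdot> (p \<cdot> q)\<close> are two active/inert factorisations of one morphism,
  so \<open>x\<close> is invertible and \<open>p\<close> is active.\<close>

lemma active_if_comp_active:
  assumes p: "p \<in> hom C B D" and q: "q \<in> hom C A B" and pq: "p \<cdot> q \<in> act C A D"
  shows "p \<in> act C B D"
proof -
  obtain W y x where y: "y \<in> act C B W" and x: "x \<in> inert C W D" and pxy: "p = x \<cdot> y"
    using factorisation[OF p] by blast
  obtain r where "active_retraction C x r"
    using M1[OF x] by blast
  then have r: "r \<in> act C D W" "r \<cdot> x = Id C W"
    using active_retraction_iff[OF x] by auto
  have yq: "y \<cdot> q \<in> hom C A W"
    using Comp_hom[OF q act_hom[OF y]] .
  have eq: "x \<cdot> (y \<cdot> q) = p \<cdot> q"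
    using Comp_assoc[OF q act_hom[OF y] inert_hom[OF x]] pxy by simp
  then have "y \<cdot> q = r \<cdot> (p \<cdot> q)"
    using Comp_assoc[OF yq inert_hom[OF x] act_hom[OF r(1)]] r(2) Comp_Id_left[OF yq] by simp
  then have yq_act: "y \<cdot> q \<in> act C A W"
    using act_comp[OF pq r(1)] by simp
  have D: "D \<in> Obj C"
    using p Cod_Obj by (auto simp: hom_def)
  have "x \<cdot> (y \<cdot> q) = Id C D \<cdot> (p \<cdot> q)"
    using eq Comp_Id_left[OF act_hom[OF pq]] by simp
  then obtain h where "h \<in> isos C W D" "x = Id C D \<cdot> h"
    using factorisation_unique[OF yq_act x pq iso_inert[OF Id_iso[OF D]]] by blast
  then have "x \<in> isos C W D"
    using Comp_Id_left iso_hom by metis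
  then show ?thesis
    using act_comp[OF y iso_act] pxy by simp
qed

section \<open>Inert sections over units, and what moments fix\<close>

lemma unit_sectionE:
  assumes "unit_object C V" and "e \<in> act C A V"
  obtains m where "m \<in> inert C V A" "e \<cdot> m = Id C V"
  using assms unfolding unit_object_def by blast

lemma unit_section_unique:
  assumes "unit_object C V" and "e \<in> act C A V"
    and "m \<in> inert C V A" "e \<cdot> m = Id C V" and "m' \<in> inert C V A" "e \<cdot> m' = Id C V"
  shows "m = m'"
  using assms unfolding unit_object_def by blast

text \<open>Restricting \<open>e\<close> along \<open>i\<close> gives another active morphism onto
  the unit, with its own inert section \<open>n\<close>. Since \<open>i \<cdot> n\<close> is then an
  inert section of \<open>e\<close>, uniqueness in (U2) forces it to be \<open>m\<close>.\<close>

lemma unit_section_factors: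
  assumes V: "unit_object C V" and e: "e \<in> act C A V"
    and m: "m \<in> inert C V A" "e \<cdot> m = Id C V"
    and i: "i \<in> inert C X A" and ei: "e \<cdot> i \<in> act C X V"
  obtains n where "n \<in> inert C V X" "m = i \<cdot> n" "(e \<cdot> i) \<cdot> n = Id C V"
proof -
  obtain n where n: "n \<in> inert C V X" "(e \<cdot> i) \<cdot> n = Id C V"
    using unit_sectionE[OF V ei] .
  then have "i \<cdot> n \<in> inert C V A" "e \<cdot> (i \<cdot> n) = Id C V"
    using inert_comp[OF n(1) i]
      Comp_assoc[OF inert_hom[OF n(1)] inert_hom[OF i] act_hom[OF e]] by auto
  then have "m = i \<cdot> n"
    using unit_section_unique[OF V e m] by blast
  then show ?thesis using that n by blast
qed

lemma split_idempotent_fixes: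
  assumes i: "i \<in> inert C X A" and a: "a \<in> act C A X" and ai: "a \<cdot> i = Id C X"
    and n: "n \<in> hom C V X"
  shows "(i \<cdot> a) \<cdot> (i \<cdot> n) = i \<cdot> n"
proof -
  have "(i \<cdot> a) \<cdot> (i \<cdot> n) = i \<cdot> (a \<cdot> (i \<cdot> n))"
    using Comp_assoc[OF Comp_hom[OF n inert_hom[OF i]] act_hom[OF a] inert_hom[OF i]] .
  also have "a \<cdot> (i \<cdot> n) = n"
    using Comp_assoc[OF n inert_hom[OF i] act_hom[OF a]] ai Comp_Id_left[OF n] by simp
  finally show ?thesis .
qed

text \<open>Because \<open>\<beta>\<close> fixes \<open>b\<close>, the order relation can be tested
  on the inert part of \<open>\<beta>\<close> alone.\<close>

lemma submoment_section:
  assumes \<beta>: "splitting C B \<beta> V b p" and le: "submoment C B \<beta> \<psi>"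
  shows "\<psi> \<cdot> b = b"
proof -
  have b: "b \<in> hom C V B" and p: "p \<in> hom C B V" and pb: "p \<cdot> b = Id C V"
    and \<beta>_def: "\<beta> = b \<cdot> p"
    using \<beta> act_hom inert_hom by (auto simp: splitting_def)
  have \<psi>: "\<psi> \<in> hom C B B"
    using le act_hom inert_hom Comp_hom
    by (force simp: submoment_def moments_def splits_over_def splitting_def)
  have \<beta>b: "\<beta> \<cdot> b = b"
    using Comp_assoc[OF b p b] pb Comp_Id_right[OF b] \<beta>_def by simp
  have "\<psi> \<cdot> b = \<psi> \<cdot> (\<beta> \<cdot> b)"
    using \<beta>b by simp
  also have "\<dots> = (\<psi> \<cdot> \<beta>) \<cdot> b"
    using Comp_assoc[OF b Comp_hom[OF p b] \<psi>] \<beta>_def by simp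
  finally show ?thesis
    using le \<beta>b by (simp add: submoment_def)
qed

section \<open>Elementary moments below a pushforward\<close>

lemma pushforwardE:
  assumes "f \<in> hom C A B" and "\<phi> \<in> moments C A"
  obtains X i a Y g j s where "splitting C A \<phi> X i a" "g \<in> act C X Y" "j \<in> inert C Y B"
    "f \<cdot> i = j \<cdot> g" "s \<in> act C B Y" "s \<cdot> j = Id C Y" "pushforward C f \<phi> = j \<cdot> s"
proof -
  have "Dom C f = A" "Cod C f = B" using assms(1) by (auto simp: hom_def)
  with is_pushforward_pushforward[OF assms] show ?thesis
    using that active_retraction_iff unfolding is_pushforward_def by metis
qed

text \<open>Lying below the pushforward makes \<open>b\<close> factor through its inert part
  \<open>j\<close>, so \<open>p \<cdot> j\<close> has a section and is active by cancellation.
  Transporting this along \<open>f \<cdot> i = j \<cdot> g\<close> and cancelling once more makes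
  \<open>p \<cdot> f\<close> active.\<close>

lemma active_comp_if_below_pushforward:
  assumes f: "f \<in> hom C A B" and \<phi>: "\<phi> \<in> moments C A"
    and \<beta>: "splitting C B \<beta> V b p" and le: "submoment C B \<beta> (pushforward C f \<phi>)"
  obtains X i a where "splitting C A \<phi> X i a" "p \<cdot> f \<in> act C A V" "(p \<cdot> f) \<cdot> i \<in> act C X V"
proof -
  obtain X i a Y g j s where sp: "splitting C A \<phi> X i a"
    and g: "g \<in> act C X Y" and j: "j \<in> inert C Y B" and fi: "f \<cdot> i = j \<cdot> g"
    and s: "s \<in> act C B Y" and push: "pushforward C f \<phi> = j \<cdot> s"
    using pushforwardE[OF f \<phi>] by metis
  have i: "i \<in> inert C X A"
    using sp by (simp add: splitting_def)
  have b: "b \<in> inert C V B" and p: "p \<in> act C B V" and pb: "p \<cdot> b = Id C V"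
    using \<beta> by (auto simp: splitting_def)
  note J = inert_hom[OF j] and S = act_hom[OF s] and P = act_hom[OF p] and Bh = inert_hom[OF b]
  \<comment> \<open>The pushforward \<open>j \<cdot> s\<close> fixes \<open>b\<close>, so
    \<open>s \<cdot> b\<close> is the factor of \<open>b\<close> through \<open>j\<close>.\<close>
  have "j \<cdot> (s \<cdot> b) = b"
    using submoment_section[OF \<beta> le] Comp_assoc[OF Bh S J] push by simp
  then have pj_section: "(p \<cdot> j) \<cdot> (s \<cdot> b) = Id C V"
    using Comp_assoc[OF Comp_hom[OF Bh S] J P] pb by simp
  have "V \<in> Obj C"
    using P Cod_Obj by (auto simp: hom_def)
  then have pj: "p \<cdot> j \<in> act C Y V"
    using active_if_comp_active[OF Comp_hom[OF J P] Comp_hom[OF Bh S]] pj_section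
      iso_act[OF Id_iso] by simp
  have "(p \<cdot> f) \<cdot> i = (p \<cdot> j) \<cdot> g"
    using Comp_assoc[OF inert_hom[OF i] f P] Comp_assoc[OF act_hom[OF g] J P] fi by simp
  then have pfi: "(p \<cdot> f) \<cdot> i \<in> act C X V"
    using act_comp[OF g pj] by simp
  show ?thesis
    using that sp pfi active_if_comp_active[OF Comp_hom[OF f P] inert_hom[OF i] pfi] by blast
qed

section \<open>Pulling elementary moments back\<close>

lemma section_splitting:
  assumes "e \<in> act C A V" "m \<in> inert C V A" "e \<cdot> m = Id C V"
  shows "splitting C A (m \<cdot> e) V m e"
  using assms by (simp add: splitting_def)

lemma splitting_elementary:
  "unit_object C U \<Longrightarrow> splitting C A \<alpha> U i a \<Longrightarrow> \<alpha> \<in> elementary_moments C A"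
  unfolding elementary_moments_def moments_def splits_over_def by blast

lemma elementary_moment: "\<alpha> \<in> elementary_moments C A \<Longrightarrow> \<alpha> \<in> moments C A"
  by (simp add: elementary_moments_def)

lemma elementary_splittingE:
  assumes "\<alpha> \<in> elementary_moments C A"
  obtains U i a where "unit_object C U" "splitting C A \<alpha> U i a"
  using assms unfolding elementary_moments_def splits_over_def by blast

text \<open>Since \<open>(p \<cdot> f) \<cdot> i\<close> is active, the section \<open>m\<close>
  factors through the inert part \<open>i\<close> of \<phi>, hence \<phi> fixes it. As
  \<open>m\<close> is determined by \<open>p \<cdot> f\<close>, the same pullback serves for every
  such \<phi>.\<close>

lemma pullback_below:
  assumes f: "f \<in> hom C A B" and \<phi>: "\<phi> \<in> moments C A"
    and V: "unit_object C V" and \<beta>: "splitting C B \<beta> V b p"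
    and le: "submoment C B \<beta> (pushforward C f \<phi>)"
    and m: "m \<in> inert C V A" "(p \<cdot> f) \<cdot> m = Id C V"
  shows "submoment C A (m \<cdot> (p \<cdot> f)) \<phi>"
proof -
  obtain X i a where sp: "splitting C A \<phi> X i a"
    and e: "p \<cdot> f \<in> act C A V" and ei: "(p \<cdot> f) \<cdot> i \<in> act C X V"
    using active_comp_if_below_pushforward[OF f \<phi> \<beta> le] .
  have i: "i \<in> inert C X A" and a: "a \<in> act C A X" and ai: "a \<cdot> i = Id C X"
    and \<phi>_def: "\<phi> = i \<cdot> a"
    using sp by (auto simp: splitting_def)
  obtain n where n: "n \<in> inert C V X" "m = i \<cdot> n"
    using unit_section_factors[OF V e m i ei] .
  have "\<phi> \<cdot> m = m"
    using split_idempotent_fixes[OF i a ai inert_hom[OF n(1)]] n(2) \<phi>_def by simp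
  then have "\<phi> \<cdot> (m \<cdot> (p \<cdot> f)) = m \<cdot> (p \<cdot> f)"
    using Comp_assoc[OF act_hom[OF e] inert_hom[OF m(1)]] Comp_hom[OF act_hom[OF a] inert_hom[OF i]]
      \<phi>_def by metis
  moreover have "m \<cdot> (p \<cdot> f) \<in> moments C A"
    using elementary_moment[OF splitting_elementary[OF V section_splitting[OF e m]]] .
  ultimately show ?thesis
    using \<phi> by (simp add: submoment_def)
qed

text \<open>Here \<open>g\<close> is a section of \<open>p \<cdot> j\<close>, so
  \<open>p \<cdot> j\<close> is active; hence the inert section \<open>b\<close> of \<open>p\<close>
  factors through \<open>j\<close> and is fixed by the pushforward
  \<open>j \<cdot> s\<close>.\<close>

lemma below_pushforward_pullback:
  assumes f: "f \<in> act C A B" and V: "unit_object C V" and \<beta>: "splitting C B \<beta> V b p"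
    and m: "m \<in> inert C V A" "(p \<cdot> f) \<cdot> m = Id C V"
  shows "submoment C B \<beta> (pushforward C f (m \<cdot> (p \<cdot> f)))"
proof -
  have b: "b \<in> inert C V B" and p: "p \<in> act C B V" and pb: "p \<cdot> b = Id C V" and \<beta>_def: "\<beta> = b \<cdot> p"
    using \<beta> by (auto simp: splitting_def)
  note F = act_hom[OF f] and P = act_hom[OF p] and M = inert_hom[OF m(1)]
  have e: "p \<cdot> f \<in> act C A V"
    using act_comp[OF f p] .
  let ?\<alpha> = "m \<cdot> (p \<cdot> f)"
  have sp: "splitting C A ?\<alpha> V m (p \<cdot> f)"
    using section_splitting[OF e m] .
  obtain Y g j where g: "g \<in> act C V Y" and j: "j \<in> inert C Y B" and fm: "f \<cdot> m = j \<cdot> g"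
    using factorisation[OF Comp_hom[OF M F]] by blast
  obtain s where ret: "active_retraction C j s"
    using M1[OF j] by blast
  then have s: "s \<in> act C B Y" "s \<cdot> j = Id C Y"
    using active_retraction_iff[OF j] by auto
  have "Dom C f = A" "Cod C f = B" using F by (auto simp: hom_def)
  then have "is_pushforward C f ?\<alpha> (j \<cdot> s)"
    using sp g j fm ret unfolding is_pushforward_def by blast
  moreover have \<alpha>: "?\<alpha> \<in> moments C A"
    using elementary_moment[OF splitting_elementary[OF V sp]] .
  \<comment> \<open>The pushforward may be computed from the splitting \<open>m\<close>,
    \<open>p \<cdot> f\<close>, since it does not depend on the choice of factorisations.\<close>
  ultimately have push: "pushforward C f ?\<alpha> = j \<cdot> s"
    using pushforward_unique[OF F] is_pushforward_pushforward[OF F] by blast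
  note J = inert_hom[OF j]
  have "(p \<cdot> j) \<cdot> g = Id C V"
    using Comp_assoc[OF M F P] Comp_assoc[OF act_hom[OF g] J P] fm m(2) by simp
  moreover have "V \<in> Obj C"
    using P Cod_Obj by (auto simp: hom_def)
  ultimately have pj: "p \<cdot> j \<in> act C Y V"
    using active_if_comp_active[OF Comp_hom[OF J P] act_hom[OF g]] iso_act[OF Id_iso] by simp
  obtain k where k: "k \<in> inert C V Y" "b = j \<cdot> k"
    using unit_section_factors[OF V p b pb j pj] .
  have "(j \<cdot> s) \<cdot> b = b"
    using split_idempotent_fixes[OF j s inert_hom[OF k(1)]] k(2) by simp
  then have "(j \<cdot> s) \<cdot> \<beta> = \<beta>"
    using Comp_assoc[OF P inert_hom[OF b] Comp_hom[OF act_hom[OF s(1)] J]] \<beta>_def by simp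
  then show ?thesis
    using push pushforward_moment[OF F \<alpha>] elementary_moment[OF splitting_elementary[OF V \<beta>]]
    by (simp add: submoment_def)
qed

lemma disjoint_moments_pushforward:
  assumes f: "f \<in> hom C A B" and disj: "disjoint_moments C A \<phi> \<psi>"
  shows "disjoint_moments C B (pushforward C f \<phi>) (pushforward C f \<psi>)"
proof -
  have \<phi>: "\<phi> \<in> moments C A" and \<psi>: "\<psi> \<in> moments C A"
    using disj by (auto simp: disjoint_moments_def)
  have False if \<epsilon>: "\<epsilon> \<in> elementary_moments C B"
    and le: "submoment C B \<epsilon> (pushforward C f \<phi>)" "submoment C B \<epsilon> (pushforward C f \<psi>)" for \<epsilon>
  proof -
    obtain V b p where V: "unit_object C V" and sp: "splitting C B \<epsilon> V b p"
      using elementary_splittingE[OF \<epsilon>] .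
    have e: "p \<cdot> f \<in> act C A V"
      using active_comp_if_below_pushforward[OF f \<phi> sp le(1)] .
    \<comment> \<open>This one section, built from \<epsilon> and \<open>f\<close>, yields an
      elementary moment below both \<phi> and \<psi>.\<close>
    obtain m where m: "m \<in> inert C V A" "(p \<cdot> f) \<cdot> m = Id C V"
      using unit_sectionE[OF V e] .
    show False
      using disj splitting_elementary[OF V section_splitting[OF e m]]
        pullback_below[OF f \<phi> V sp le(1) m] pullback_below[OF f \<psi> V sp le(2) m]
      unfolding disjoint_moments_def by blast
  qed
  then show ?thesis
    using pushforward_moment[OF f \<phi>] pushforward_moment[OF f \<psi>]
    unfolding disjoint_moments_def by blast
qed

text \<open>This is the covering half of the partition: \<open>p \<cdot> f\<close> is a composite of
  active morphisms, so each \<beta> has a pullback to serve as its index.\<close>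

lemma elementary_below_pushforward_ex:
  assumes f: "f \<in> act C A B" and \<beta>: "\<beta> \<in> elementary_moments C B"
  shows "\<exists>\<alpha> \<in> elementary_moments C A. submoment C B \<beta> (pushforward C f \<alpha>)"
proof -
  obtain V b p where V: "unit_object C V" and sp: "splitting C B \<beta> V b p"
    using elementary_splittingE[OF \<beta>] .
  have e: "p \<cdot> f \<in> act C A V"
    using sp act_comp[OF f] by (simp add: splitting_def)
  obtain m where m: "m \<in> inert C V A" "(p \<cdot> f) \<cdot> m = Id C V"
    using unit_sectionE[OF V e] .
  show ?thesis
    using below_pushforward_pullback[OF f V sp m] splitting_elementary[OF V section_splitting[OF e m]]
    by blast
qed

end

section \<open>Rigidity of elementary moments in the unital case\<close>

context unital_moment_category
begin

text \<open>Both \<open>c\<close> and \<open>Id C V\<close> exhibit a unit with an active morphism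
  to \<open>V\<close>; essential uniqueness compares them by an isomorphism, which must be
  \<open>c\<close> itself.\<close>

lemma act_between_units_iso:
  assumes "unit_object C U" "unit_object C V" and c: "c \<in> act C U V"
  shows "c \<in> isos C U V"
proof -
  have V: "V \<in> Obj C"
    using act_hom[OF c] Cod_Obj by (auto simp: hom_def)
  obtain h where "h \<in> isos C U V" "Id C V \<cdot> h = c"
    using unital_unique[OF assms(1) c assms(2) iso_act[OF Id_iso[OF V]]] by blast
  then show ?thesis
    using Comp_Id_left iso_hom by metis
qed

text \<open>The comparison maps \<open>a \<cdot> m\<close> and \<open>e \<cdot> i\<close> between
  the two units turn out to be mutually inverse, and then (M2) identifies the two
  splittings.\<close>

lemma elementary_submoment_eq:
  assumes \<alpha>: "\<alpha> \<in> elementary_moments C A" and \<alpha>': "\<alpha>' \<in> elementary_moments C A"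
    and le: "submoment C A \<alpha> \<alpha>'"
  shows "\<alpha> = \<alpha>'"
proof -
  obtain V m e where V: "unit_object C V" and sp: "splitting C A \<alpha> V m e"
    using elementary_splittingE[OF \<alpha>] .
  obtain U i a where U: "unit_object C U" and sp': "splitting C A \<alpha>' U i a"
    using elementary_splittingE[OF \<alpha>'] .
  have m: "m \<in> inert C V A" and e: "e \<in> act C A V" and em: "e \<cdot> m = Id C V" and \<alpha>_def: "\<alpha> = m \<cdot> e"
    using sp by (auto simp: splitting_def)
  have i: "i \<in> inert C U A" and a: "a \<in> act C A U" and ai: "a \<cdot> i = Id C U" and \<alpha>'_def: "\<alpha>' = i \<cdot> a"
    using sp' by (auto simp: splitting_def)
  note M = inert_hom[OF m] and E = act_hom[OF e] and I = inert_hom[OF i] and A = act_hom[OF a]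
  have am: "a \<cdot> m \<in> hom C V U" and ei: "e \<cdot> i \<in> hom C U V"
    using Comp_hom[OF M A] Comp_hom[OF I E] by auto
  have iam: "i \<cdot> (a \<cdot> m) = m"
    using submoment_section[OF sp le] Comp_assoc[OF M A I] \<alpha>'_def by simp
  then have eiam: "(e \<cdot> i) \<cdot> (a \<cdot> m) = Id C V"
    using Comp_assoc[OF am I E] em by simp
  have "V \<in> Obj C"
    using E Cod_Obj by (auto simp: hom_def)
  then have ei_act: "e \<cdot> i \<in> act C U V"
    using active_if_comp_active[OF ei am] eiam iso_act[OF Id_iso] by simp
  then obtain l where l: "l \<in> hom C V U" "l \<cdot> (e \<cdot> i) = Id C U"
    using act_between_units_iso[OF U V] by (auto simp: isos_def)
  \<comment> \<open>A right inverse of the isomorphism \<open>e \<cdot> i\<close> is its two-sided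
    inverse.\<close>
  have "l = a \<cdot> m"
    using Comp_assoc[OF am ei l(1)] eiam l(2) Comp_Id_left[OF am] Comp_Id_right[OF l(1)] by simp
  then have inv: "(a \<cdot> m) \<cdot> (e \<cdot> i) = Id C U"
    using l(2) by simp
  \<comment> \<open>(M2) applies because \<open>e\<close> and \<open>e \<cdot> i\<close> are both
    active and \<open>a\<close> is the active retraction of \<open>i\<close>.\<close>
  have "e = (e \<cdot> i) \<cdot> a"
    using M2[OF i e ei_act refl] active_retraction_iff[OF i] a ai by blast
  then have "\<alpha> = (i \<cdot> (a \<cdot> m)) \<cdot> ((e \<cdot> i) \<cdot> a)"
    using \<alpha>_def iam by simp
  also have "\<dots> = i \<cdot> ((a \<cdot> m) \<cdot> ((e \<cdot> i) \<cdot> a))"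
    using Comp_assoc[OF Comp_hom[OF A ei] am I] .
  also have "(a \<cdot> m) \<cdot> ((e \<cdot> i) \<cdot> a) = a"
    using Comp_assoc[OF A ei am] inv Comp_Id_left[OF A] by simp
  finally show ?thesis
    using \<alpha>'_def by simp
qed

text \<open>A shared \<beta> prevents the two pushforwards from being disjoint, so \<alpha> and
  \<alpha>' have a common elementary submoment, which equals each of them.\<close>

lemma elementary_below_pushforward_unique:
  assumes f: "f \<in> hom C A B" and \<beta>: "\<beta> \<in> elementary_moments C B"
    and \<alpha>: "\<alpha> \<in> elementary_moments C A" and \<alpha>': "\<alpha>' \<in> elementary_moments C A"
    and le: "submoment C B \<beta> (pushforward C f \<alpha>)" "submoment C B \<beta> (pushforward C f \<alpha>')"
  shows "\<alpha> = \<alpha>'"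
proof -
  have "\<not> disjoint_moments C B (pushforward C f \<alpha>) (pushforward C f \<alpha>')"
    using \<beta> le unfolding disjoint_moments_def by blast
  then have "\<not> disjoint_moments C A \<alpha> \<alpha>'"
    using disjoint_moments_pushforward[OF f] by blast
  then obtain \<epsilon> where "\<epsilon> \<in> elementary_moments C A" "submoment C A \<epsilon> \<alpha>" "submoment C A \<epsilon> \<alpha>'"
    using elementary_moment[OF \<alpha>] elementary_moment[OF \<alpha>'] unfolding disjoint_moments_def by blast
  then show ?thesis
    using elementary_submoment_eq \<alpha> \<alpha>' by metis
qed

end

theorem proposition2p5:
  fixes C :: "('o, 'm) ai_cat" and A B :: 'o and f :: 'm
  assumes "unital_moment_category C"
    and "f \<in> hom C A B"
  shows "(\<forall>\<phi> \<psi>. disjoint_moments C A \<phi> \<psi> \<longrightarrow>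
            disjoint_moments C B (pushforward C f \<phi>) (pushforward C f \<psi>)) \<and>
         (f \<in> act C A B \<longrightarrow>
            (\<Union>\<alpha> \<in> elementary_moments C A.
               {\<beta> \<in> elementary_moments C B. submoment C B \<beta> (pushforward C f \<alpha>)})
              = elementary_moments C B \<and>
            disjoint_family_on
              (\<lambda>\<alpha>. {\<beta> \<in> elementary_moments C B. submoment C B \<beta> (pushforward C f \<alpha>)})
              (elementary_moments C A))"
proof -
  interpret unital_moment_category C by fact
  note f = \<open>f \<in> hom C A B\<close>
  have "disjoint_family_on
      (\<lambda>\<alpha>. {\<beta> \<in> elementary_moments C B. submoment C B \<beta> (pushforward C f \<alpha>)})
      (elementary_moments C A)"
    using elementary_below_pushforward_unique[OF f] unfolding disjoint_family_on_def by blast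
  moreover have "(\<Union>\<alpha> \<in> elementary_moments C A.
      {\<beta> \<in> elementary_moments C B. submoment C B \<beta> (pushforward C f \<alpha>)}) = elementary_moments C B"
    if "f \<in> act C A B"
    using elementary_below_pushforward_ex[OF that] by blast
  ultimately show ?thesis
    using disjoint_moments_pushforward[OF f] by blast
qed

end
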